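(* Let $f:\mathbb R\to[0,\infty)$ be a continuous, compactly supported function of bounded variation. Then $f$ has finite unimodal category, $\mathbf{ucat}(f)<\infty$, if and only if both of the following hold: (1) $f^{-1}(0,\infty)=\bigcup_{j=1}^m(a_j,b_j)$ for some integer $m\ge 0$ and some $-\infty\le a_1<b_1\le a_2<b_2\le\dots\le a_m<b_m\le\infty$; and (2) there is an $\epsilon>0$ such that, for each $j=1,\dots,m$, $f$ is increasing on $[a_j,a_j+\epsilon]$ and decreasing on $[b_j-\epsilon,b_j]$.
   Context: A continuous function $u:X\to[0,\infty)$ on a topological space is unimodal if there is $M>0$ such that the superlevel set $u^{-1}[c,\infty)$ is contractible for $0<c\le M$ and empty for $c>M$. The unimodal category $\mathbf{ucat}(f)$ of $f:X\to[0,\infty)$ is the minimum number $n$ of unimodal functions $u_1,\dots,u_n:X\to[0,\infty)$ with $f=\sum_{i=1}^n u_i$ pointwise ($\infty$ if there is no such $n$; the empty sum is $0$). Bounded variation means that $\sup\sum_{i=1}^k|f(t_i)-f(t_{i-1})|<\infty$, the supremum being over all finite sequences $t_0<\dots<t_k$ in $\mathbb R$. "Increasing" and "decreasing" are meant in the weak sense. *)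

theory Defs
  imports "HOL-Analysis.Analysis" "HOL-Library.Extended_Nat"
begin

(* The library predicate contractible holds of the empty set, whereas a contractible space
   is nonempty (homotopy equivalent to a point); hence the separate nonemptiness clause. *)
definition unimodal :: "('a::topological_space \<Rightarrow> real) \<Rightarrow> bool" where
  "unimodal u \<longleftrightarrow>
     continuous_on UNIV u \<and> (\<forall>x. 0 \<le> u x) \<and>
     (\<exists>M>0. (\<forall>c. 0 < c \<and> c \<le> M \<longrightarrow> u -` {c..} \<noteq> {} \<and> contractible (u -` {c..})) \<and>
            (\<forall>c>M. u -` {c..} = {}))"

(* The infimum in enat of the empty set is infinity. *)
definition ucat :: "('a::topological_space \<Rightarrow> real) \<Rightarrow> enat" where
  "ucat f = Inf {enat n | n. \<exists>u :: nat \<Rightarrow> 'a \<Rightarrow> real.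
     (\<forall>i\<in>{1..n}. unimodal (u i)) \<and> (\<forall>x. f x = (\<Sum>i=1..n. u i x))}"

definition bounded_variation :: "(real \<Rightarrow> real) \<Rightarrow> bool" where
  "bounded_variation f \<longleftrightarrow>
     bdd_above {\<Sum>i=1..k. \<bar>f (t i) - f (t (i - 1))\<bar> | (k::nat) (t :: nat \<Rightarrow> real).
       \<forall>i\<in>{1..k}. t (i - 1) < t i}"

end

theory Submission
  imports Defs
begin

text \<open>On the real line the superlevel sets of a unimodal function are intervals, so a continuous
nonnegative function is unimodal iff it has a positive value \<open>u p\<close> such that it increases up to \<open>p\<close>
and decreases from \<open>p\<close> on.

Suppose \<open>f\<close> is a sum of \<open>n\<close> unimodal functions.  Each summand is positive on an interval on which
\<open>f\<close> has no zero, hence inside a single excursion of \<open>f\<close> from zero, and every excursion contains a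
point where some summand is positive; so there are at most \<open>n\<close> excursions.  At an endpoint of an
excursion every summand vanishes, and a unimodal function is monotone close to each of its zeros,
in the direction that is needed.  Summing up, \<open>f\<close> is monotone near the ends
(\<open>monotone_ends_of_ucat_finite\<close>).

Conversely, it suffices to write a single excursion over \<open>(a, b)\<close> as a finite sum.  Let \<open>f\<close>
increase on \<open>[a, c]\<close> and decrease on \<open>[d, b]\<close>, and let \<open>\<delta> > 0\<close> be the minimum of \<open>f\<close> on \<open>[c, d]\<close>.
Parametrise \<open>[c, d]\<close> by \<open>w x = V x + x\<close>, where \<open>V\<close> is the variation of \<open>f\<close> up to \<open>x\<close>; in this
parameter \<open>f\<close> has Lipschitz constant 1.  A hat function in \<open>w\<close> with slopes \<open>1 / h\<close> and \<open>-1 / h\<close>, where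
\<open>h \<le> \<delta>\<close>, is so steep that its product with \<open>f\<close> still increases where the hat increases and
decreases where it decreases (\<open>steep_cutoff\<close>).  Finitely many such hats add up to 1, and the
products of \<open>f\<close> with them are the required unimodal functions (\<open>excursion.ucat_finite\<close>).

The pieces are continuous because \<open>V\<close> is.  This is derived from the fact that \<open>V\<close> is the least
nonnegative function with \<open>\<bar>f y - f x\<bar> \<le> V y - V x\<close> for \<open>x \<le> y\<close>: a jump of \<open>V\<close> could be removed without
destroying these inequalities (\<open>continuous_variation\<close>).\<close>

section \<open>Unimodal functions on the real line\<close>

definition has_peak :: "(real \<Rightarrow> real) \<Rightarrow> real \<Rightarrow> bool" where
  "has_peak u p \<longleftrightarrow> mono_on {..p} u \<and> antimono_on {p..} u"

text \<open>A contractible subset of the line is an interval, and a nonempty interval is contractible.  So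
unimodality says that the superlevel sets are intervals all containing a maximum point, that is,
that the function rises to a peak and falls afterwards.\<close>

lemma unimodal_iff_has_peak:
  fixes u :: "real \<Rightarrow> real"
  shows "unimodal u \<longleftrightarrow>
    continuous_on UNIV u \<and> (\<forall>x. 0 \<le> u x) \<and> (\<exists>p. has_peak u p \<and> 0 < u p)"
    (is "_ \<longleftrightarrow> ?peaked")
proof
  assume u: "unimodal u"
  from u obtain M where "M > 0"
    and M: "\<And>c. 0 < c \<Longrightarrow> c \<le> M \<Longrightarrow> u -` {c..} \<noteq> {} \<and> contractible (u -` {c..})"
    and above: "\<And>c. c > M \<Longrightarrow> u -` {c..} = {}"
    by (auto simp: unimodal_def)
  from M[of M] \<open>M > 0\<close> obtain p where p: "M \<le> u p" by auto
  have le: "u x \<le> M" for x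
    using above[of "u x"] by (cases "u x \<le> M") auto
  have between: "u x \<le> u y" if "x \<le> y \<and> y \<le> p \<or> p \<le> y \<and> y \<le> x" for x y
  proof (cases "u x > 0")
    case True
    have "is_interval (u -` {u x..})"
      using M[OF True le] contractible_imp_connected is_interval_connected_1 by blast
    moreover have "x \<in> u -` {u x..}" "p \<in> u -` {u x..}"
      using p le[of x] by auto
    ultimately have "y \<in> u -` {u x..}"
      using that unfolding is_interval_1 by blast
    then show ?thesis by simp
  next
    case False
    with u have "u x = 0" "0 \<le> u y" by (auto simp: unimodal_def order_antisym)
    then show ?thesis by simp
  qed
  have "has_peak u p"
    unfolding has_peak_def by (intro conjI monotone_onI between) auto
  moreover have "0 < u p"
    using p \<open>M > 0\<close> by linarith
  ultimately show ?peaked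
    using u unfolding unimodal_def by blast
next
  assume ?peaked
  then obtain p where cont: "continuous_on UNIV u" and nonneg: "\<forall>x. 0 \<le> u x"
    and peak: "has_peak u p" and pos: "0 < u p"
    by blast
  have up: "u x \<le> u y" if "x \<le> y" "y \<le> p" for x y
    using peak that by (auto simp: has_peak_def monotone_on_def)
  have down: "u y \<le> u x" if "p \<le> x" "x \<le> y" for x y
    using peak that by (auto simp: has_peak_def monotone_on_def)
  have "is_interval (u -` {c..})" for c
    unfolding is_interval_1
  proof (intro ballI allI impI)
    fix x y z assume "x \<in> u -` {c..}" "y \<in> u -` {c..}" "x \<le> z \<and> z \<le> y"
    then show "z \<in> u -` {c..}"
      using up[of x z] down[of z y] by (cases "z \<le> p") auto
  qed
  then have "contractible (u -` {c..})" for c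
    using is_interval_convex_1 convex_imp_contractible by blast
  moreover have "u -` {c..} \<noteq> {}" if "c \<le> u p" for c
    using that by auto
  moreover have "u -` {c..} = {}" if "c > u p" for c
  proof -
    have "u x \<le> u p" for x
      using up[of x p] down[of p x] by linarith
    with that have "\<not> c \<le> u x" for x using le_less_trans not_le by metis
    then show ?thesis by auto
  qed
  ultimately show "unimodal u"
    unfolding unimodal_def using cont nonneg pos by blast
qed

section \<open>Finiteness of the unimodal category\<close>

lemma ucat_finite_iff:
  "ucat f < \<infinity> \<longleftrightarrow> (\<exists>(n::nat) u. (\<forall>i\<in>{1..n}. unimodal (u i)) \<and> (\<forall>x. f x = (\<Sum>i=1..n. u i x)))"
  unfolding ucat_def Inf_less_iff mem_Collect_eq
  using enat_ord_simps(4) by blast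

lemma ucat_add_finite:
  assumes "ucat f < \<infinity>" "ucat g < \<infinity>"
  shows "ucat (\<lambda>x. f x + g x) < \<infinity>"
proof -
  obtain n :: nat and u
    where u: "\<And>i. i \<in> {1..n} \<Longrightarrow> unimodal (u i)" "\<And>x. f x = (\<Sum>i=1..n. u i x)"
    using assms(1) unfolding ucat_finite_iff by blast
  obtain m :: nat and v
    where v: "\<And>i. i \<in> {1..m} \<Longrightarrow> unimodal (v i)" "\<And>x. g x = (\<Sum>i=1..m. v i x)"
    using assms(2) unfolding ucat_finite_iff by blast
  define w where "w i = (if i \<le> n then u i else v (i - n))" for i
  have "(\<Sum>i=1..n+m. w i x) = f x + g x" for x
  proof -
    have "(\<Sum>i=1..n+m. w i x) = (\<Sum>i=1..n. w i x) + (\<Sum>i=n+1..n+m. w i x)"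
      by (rule sum.ub_add_nat) simp
    also have "(\<Sum>i=n+1..n+m. w i x) = (\<Sum>i=1..m. w (i + n) x)"
      using sum.shift_bounds_cl_nat_ivl[of "\<lambda>i. w i x" 1 n m] by (simp add: add.commute)
    also have "\<dots> = g x"
      by (simp add: w_def v)
    finally show ?thesis by (simp add: w_def u)
  qed
  moreover have "unimodal (w i)" if "i \<in> {1..n+m}" for i
    using that u(1)[of i] v(1)[of "i - n"] by (auto simp: w_def Suc_le_eq le_diff_conv)
  ultimately show ?thesis
    unfolding ucat_finite_iff by (intro exI[of _ "n + m"] exI[of _ w]) auto
qed

lemma ucat_unimodal_finite: "unimodal u \<Longrightarrow> ucat u < \<infinity>"
  unfolding ucat_finite_iff by (rule exI[of _ 1], rule exI[of _ "\<lambda>_. u"]) auto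

lemma ucat_sum_finite:
  assumes "finite I" "\<And>i. i \<in> I \<Longrightarrow> ucat (g i) < \<infinity>"
  shows "ucat (\<lambda>x. \<Sum>i\<in>I. g i x) < \<infinity>"
  using assms
proof (induction I rule: finite_induct)
  case empty
  then show ?case unfolding ucat_finite_iff by (auto intro!: exI[of _ 0])
next
  case (insert i I)
  then show ?case using ucat_add_finite[of "g i" "\<lambda>x. \<Sum>i\<in>I. g i x"] by simp
qed

section \<open>The variation function\<close>

text \<open>For \<open>f\<close> of bounded variation such a \<open>w\<close> plays the role of an arc length parameter: in terms of it
\<open>f\<close> has Lipschitz constant 1.\<close>

definition dominates :: "(real \<Rightarrow> real) \<Rightarrow> (real \<Rightarrow> real) \<Rightarrow> bool" where
  "dominates w f \<longleftrightarrow> (\<forall>x y. x \<le> y \<longrightarrow> \<bar>f y - f x\<bar> \<le> w y - w x)"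

lemma dominatesD: "dominates w f \<Longrightarrow> x \<le> y \<Longrightarrow> \<bar>f y - f x\<bar> \<le> w y - w x"
  by (auto simp: dominates_def)

lemma dominates_imp_mono:
  assumes "dominates w f" "x \<le> y" shows "w x \<le> w y"
  using dominatesD[OF assms] by linarith

text \<open>Requiring the partitions to end exactly at \<open>x\<close>, not merely to lie left of it, lets one extend them
by one more point without a case distinction.  The partition with a single point (\<open>k = 0\<close>)
contributes the value 0.\<close>

definition sums_upto :: "(real \<Rightarrow> real) \<Rightarrow> real \<Rightarrow> real set" where
  "sums_upto f x = {\<Sum>i=1..k. \<bar>f (t i) - f (t (i - 1))\<bar> | (k::nat) (t :: nat \<Rightarrow> real).
     (\<forall>i\<in>{1..k}. t (i - 1) < t i) \<and> t k = x}"

definition variation :: "(real \<Rightarrow> real) \<Rightarrow> real \<Rightarrow> real" where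
  "variation f x = Sup (sums_upto f x)"

lemma sums_uptoE:
  assumes "s \<in> sums_upto f x"
  obtains k :: nat and t where "\<And>i. i \<in> {1..k} \<Longrightarrow> t (i - 1) < t i" "t k = x"
    "s = (\<Sum>i=1..k. \<bar>f (t i) - f (t (i - 1))\<bar>)"
  using assms unfolding sums_upto_def by blast

lemma zero_in_sums_upto: "0 \<in> sums_upto f x"
  unfolding sums_upto_def by (auto intro!: exI[of _ 0] exI[of _ "\<lambda>_. x"])

lemma bdd_above_sums_upto:
  assumes "bounded_variation f" shows "bdd_above (sums_upto f x)"
  by (rule bdd_above_mono[OF assms[unfolded bounded_variation_def]])
     (auto simp: sums_upto_def)

lemma variation_nonneg:
  assumes "bounded_variation f" shows "0 \<le> variation f x"
  unfolding variation_def
  by (intro cSup_upper zero_in_sums_upto bdd_above_sums_upto assms)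

lemma variation_dominates:
  assumes "bounded_variation f" shows "dominates (variation f) f"
  unfolding dominates_def
proof (intro allI impI)
  fix x y :: real assume "x \<le> y"
  show "\<bar>f y - f x\<bar> \<le> variation f y - variation f x"
  proof (cases "x = y")
    case False
    with \<open>x \<le> y\<close> have "x < y" by simp
    have "s + \<bar>f y - f x\<bar> \<le> variation f y" if "s \<in> sums_upto f x" for s
      using that
    proof (rule sums_uptoE)
      fix k :: nat and t assume t: "\<And>i. i \<in> {1..k} \<Longrightarrow> t (i - 1) < t i" "t k = x"
        and s: "s = (\<Sum>i=1..k. \<bar>f (t i) - f (t (i - 1))\<bar>)"
      define t' where "t' = t(Suc k := y)"
      have "s = (\<Sum>i=1..k. \<bar>f (t' i) - f (t' (i - 1))\<bar>)"
        unfolding s by (rule sum.cong) (auto simp: t'_def)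
      then have "s + \<bar>f y - f x\<bar> = (\<Sum>i=1..Suc k. \<bar>f (t' i) - f (t' (i - 1))\<bar>)"
        by (simp add: t'_def t(2))
      moreover have "t' (i - 1) < t' i" if "i \<in> {1..Suc k}" for i
        using that t(1)[of i] t(2) \<open>x < y\<close> by (cases "i = Suc k") (auto simp: t'_def)
      ultimately have "s + \<bar>f y - f x\<bar> \<in> sums_upto f y"
        unfolding sums_upto_def mem_Collect_eq
        by (intro exI[of _ "Suc k"] exI[of _ t'] conjI ballI) (simp_all add: t'_def)
      then show ?thesis
        unfolding variation_def by (intro cSup_upper bdd_above_sums_upto assms)
    qed
    then have "variation f x \<le> variation f y - \<bar>f y - f x\<bar>"
      unfolding variation_def[of f x] using zero_in_sums_upto
      by (intro cSup_least) (auto simp: le_diff_eq)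
    then show ?thesis by linarith
  qed simp
qed

text \<open>Minimality among the nonnegative dominating functions: the sum over a partition telescopes in
\<open>w\<close>.  Continuity of the variation is deduced from this property alone.\<close>

lemma variation_le_dominating:
  assumes w: "dominates w f" and nonneg: "\<And>z. 0 \<le> w z"
  shows "variation f x \<le> w x"
  unfolding variation_def
proof (rule cSup_least)
  show "sums_upto f x \<noteq> {}" using zero_in_sums_upto by blast
  fix s assume "s \<in> sums_upto f x"
  then show "s \<le> w x"
  proof (rule sums_uptoE)
    fix k :: nat and t assume t: "\<And>i. i \<in> {1..k} \<Longrightarrow> t (i - 1) < t i" "t k = x"
      and s: "s = (\<Sum>i=1..k. \<bar>f (t i) - f (t (i - 1))\<bar>)"
    have "s \<le> (\<Sum>i=1..k. w (t i) - w (t (i - 1)))"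
      unfolding s by (intro sum_mono dominatesD[OF w] less_imp_le t(1))
    also have "\<dots> = w (t k) - w (t 0)"
      by (induction k) auto
    also have "\<dots> \<le> w x"
      using nonneg[of "t 0"] t(2) by simp
    finally show "s \<le> w x" .
  qed
qed

text \<open>If the variation \<open>V\<close> jumped by at least \<open>J\<close> at \<open>x\<close> on the left, lowering it by \<open>J\<close> from \<open>x\<close> onwards
would leave a nonnegative function which, because \<open>f\<close> itself is continuous at \<open>x\<close>, still
dominates \<open>f\<close>.  This contradicts minimality.  The jump on the right is excluded in the same
way, lowering \<open>V\<close> only strictly to the right of \<open>x\<close>.\<close>

lemma variation_no_left_jump:
  assumes bv: "bounded_variation f" and cont: "continuous_on UNIV f" and "0 < J"
  shows "\<exists>y<x. variation f x - J < variation f y"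
proof (rule ccontr)
  let ?V = "variation f"
  assume "\<not> ?thesis"
  then have jump: "?V y \<le> ?V x - J" if "y < x" for y
    using that by (meson not_less)
  have f_tendsto: "(f \<longlongrightarrow> f x) (at x)"
    using cont by (simp add: continuous_on_def)
  have V: "\<bar>f z - f y\<bar> \<le> ?V z - ?V y" if "y \<le> z" for y z
    using dominatesD[OF variation_dominates[OF bv] that] .
  have at_x: "\<bar>f x - f y\<bar> \<le> ?V x - J - ?V y" if "y < x" for y
  proof (rule tendsto_upperbound)
    show "((\<lambda>z. \<bar>f z - f y\<bar>) \<longlongrightarrow> \<bar>f x - f y\<bar>) (at_left x)"
      using f_tendsto unfolding filterlim_at_split by (intro tendsto_intros) simp
    show "\<forall>\<^sub>F z in at_left x. \<bar>f z - f y\<bar> \<le> ?V x - J - ?V y"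
      using eventually_at_left_real[OF that]
    proof eventually_elim
      case (elim z)
      then show ?case using V[of y z] jump[of z] by auto
    qed
  qed simp
  define w where "w z = (if z < x then ?V z else ?V z - J)" for z
  have "dominates w f"
    unfolding dominates_def
  proof (intro allI impI)
    fix y z :: real assume "y \<le> z"
    then show "\<bar>f z - f y\<bar> \<le> w z - w y"
      using V[of y z] V[of x z] at_x[of y] by (auto simp: w_def)
  qed
  moreover have "0 \<le> w z" for z
    using variation_nonneg[OF bv, of z] variation_nonneg[OF bv, of "x - 1"] jump[of "x - 1"]
      dominates_imp_mono[OF variation_dominates[OF bv], of x z]
    by (auto simp: w_def)
  ultimately have "?V x \<le> w x" by (rule variation_le_dominating)
  with \<open>0 < J\<close> show False by (simp add: w_def)
qed

lemma variation_no_right_jump: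
  assumes bv: "bounded_variation f" and cont: "continuous_on UNIV f" and "0 < J"
  shows "\<exists>y>x. variation f y < variation f x + J"
proof (rule ccontr)
  let ?V = "variation f"
  assume "\<not> ?thesis"
  then have jump: "?V x + J \<le> ?V y" if "x < y" for y
    using that by (meson not_less)
  have f_tendsto: "(f \<longlongrightarrow> f x) (at x)"
    using cont by (simp add: continuous_on_def)
  have V: "\<bar>f z - f y\<bar> \<le> ?V z - ?V y" if "y \<le> z" for y z
    using dominatesD[OF variation_dominates[OF bv] that] .
  have at_x: "\<bar>f z - f x\<bar> \<le> ?V z - J - ?V x" if "x < z" for z
  proof (rule tendsto_upperbound)
    show "((\<lambda>y. \<bar>f z - f y\<bar>) \<longlongrightarrow> \<bar>f z - f x\<bar>) (at_right x)"
      using f_tendsto unfolding filterlim_at_split by (intro tendsto_intros) simp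
    show "\<forall>\<^sub>F y in at_right x. \<bar>f z - f y\<bar> \<le> ?V z - J - ?V x"
      using eventually_at_right_real[OF that]
    proof eventually_elim
      case (elim y)
      then show ?case using V[of y z] jump[of y] by auto
    qed
  qed simp
  define w where "w z = (if z \<le> x then ?V z else ?V z - J)" for z
  have "dominates w f"
    unfolding dominates_def
  proof (intro allI impI)
    fix y z :: real assume "y \<le> z"
    then show "\<bar>f z - f y\<bar> \<le> w z - w y"
      using V[of y z] V[of y x] at_x[of z] by (auto simp: w_def)
  qed
  moreover have "0 \<le> w z" for z
    using variation_nonneg[OF bv, of z] variation_nonneg[OF bv, of x] jump[of z]
    by (auto simp: w_def)
  ultimately have "?V (x + 1) \<le> w (x + 1)" by (rule variation_le_dominating)
  with \<open>0 < J\<close> show False by (simp add: w_def)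
qed

lemma continuous_variation:
  assumes bv: "bounded_variation f" and cont: "continuous_on UNIV f"
  shows "continuous_on UNIV (variation f)"
proof -
  let ?V = "variation f"
  have mono: "?V x \<le> ?V y" if "x \<le> y" for x y
    using dominates_imp_mono[OF variation_dominates[OF bv] that] .
  have "(?V \<longlongrightarrow> ?V x) (at x)" for x
  proof (rule order_tendstoI)
    fix c assume "c < ?V x"
    with variation_no_left_jump[OF bv cont, of "?V x - c" x]
    obtain y where "y < x" "c < ?V y" by auto
    then have "c < ?V z" if "dist z x < x - y" for z
      using mono[of y z] that by (simp add: dist_real_def abs_less_iff)
    with \<open>y < x\<close> show "\<forall>\<^sub>F z in at x. c < ?V z"
      unfolding eventually_at by (intro exI[of _ "x - y"]) auto
  next
    fix c assume "?V x < c"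
    with variation_no_right_jump[OF bv cont, of "c - ?V x" x]
    obtain y where "x < y" "?V y < c" by auto
    then have "?V z < c" if "dist z x < y - x" for z
      using mono[of z y] that by (simp add: dist_real_def abs_less_iff)
    with \<open>x < y\<close> show "\<forall>\<^sub>F z in at x. ?V z < c"
      unfolding eventually_at by (intro exI[of _ "y - x"]) auto
  qed
  then show ?thesis by (simp add: continuous_on_def)
qed

section \<open>Decomposing one excursion\<close>

lemma mono_on_glue:
  fixes g :: "real \<Rightarrow> real"
  assumes "mono_on {..c} g" "mono_on {c..p} g" "c \<le> p"
  shows "mono_on {..p} g"
proof (rule monotone_onI)
  fix x y assume "x \<in> {..p}" "y \<in> {..p}" "x \<le> y"
  then show "g x \<le> g y"
    using monotone_onD[OF assms(1), of x y] monotone_onD[OF assms(2), of x y]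
      monotone_onD[OF assms(1), of x c] monotone_onD[OF assms(2), of c y] assms(3)
    by (cases "y \<le> c"; cases "x \<le> c") auto
qed

lemma antimono_on_glue:
  fixes g :: "real \<Rightarrow> real"
  assumes "antimono_on {d..} g" "antimono_on {p..d} g" "p \<le> d"
  shows "antimono_on {p..} g"
proof (rule monotone_onI)
  fix x y assume "x \<in> {p..}" "y \<in> {p..}" "x \<le> y"
  then show "g y \<le> g x"
    using monotone_onD[OF assms(1), of x y] monotone_onD[OF assms(2), of x y]
      monotone_onD[OF assms(1), of d y] monotone_onD[OF assms(2), of x d] assms(3)
    by (cases "y \<le> d"; cases "x \<le> d") auto
qed

text \<open>A product increases with its second factor \<open>\<phi>\<close>, although the first factor may decrease, as soon
as \<open>\<phi>\<close> grows \<open>1 / \<delta>\<close> times faster than the first factor can vary, where \<open>\<delta>\<close> is a lower bound for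
the first factor: the loss \<open>\<bar>f'' - f'\<bar> * \<phi>'\<close> is outweighed by the gain \<open>f'' * (\<phi>'' - \<phi>')\<close>.\<close>

lemma steep_cutoff:
  fixes f' f'' \<phi>' \<phi>'' \<delta> :: real
  assumes "0 < \<delta>" "\<delta> \<le> f''" "\<bar>f'' - f'\<bar> \<le> \<delta> * (\<phi>'' - \<phi>')" "0 \<le> \<phi>'" "\<phi>' \<le> 1"
  shows "f' * \<phi>' \<le> f'' * \<phi>''"
proof -
  have "0 \<le> \<delta> * (\<phi>'' - \<phi>')" using assms(3) by linarith
  then have "0 \<le> \<phi>'' - \<phi>'" using \<open>0 < \<delta>\<close> by (simp add: zero_le_mult_iff)
  have "(f' - f'') * \<phi>' \<le> \<bar>f'' - f'\<bar> * 1"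
    using assms(4,5) by (intro mult_mono) auto
  also have "\<dots> \<le> \<delta> * (\<phi>'' - \<phi>')" using assms(3) by simp
  also have "\<dots> \<le> f'' * (\<phi>'' - \<phi>')"
    using assms(2) \<open>0 \<le> \<phi>'' - \<phi>'\<close> by (rule mult_right_mono)
  finally show ?thesis by (simp add: algebra_simps)
qed

definition ramp :: "real \<Rightarrow> real" where
  "ramp z = max 0 (min 1 z)"

text \<open>The hat function of width 2 centred at \<open>i\<close>, written as a difference of consecutive ramps so that
sums over \<open>i\<close> telescope.\<close>

definition bump :: "nat \<Rightarrow> real \<Rightarrow> real" where
  "bump i z = ramp (z - real i + 1) - ramp (z - real i)"

lemma sum_bump:
  assumes "0 \<le> z" "z \<le> real k"
  shows "(\<Sum>i\<le>k. bump i z) = 1"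
proof -
  have "(\<Sum>i\<le>k. bump i z) = (\<Sum>i\<le>k. ramp (z - real i + 1) - ramp (z - real (Suc i) + 1))"
    by (simp add: bump_def)
  also have "\<dots> = ramp (z + 1) - ramp (z - real k)"
    by (subst sum_telescope) simp
  also have "\<dots> = 1"
    using assms by (simp add: ramp_def)
  finally show ?thesis .
qed

text \<open>An excursion of \<open>f\<close> away from zero, with a rising initial part \<open>[a, c]\<close>, a falling final part
\<open>[d, b]\<close> and an arbitrary middle part on which \<open>w\<close> controls the oscillation.\<close>

locale excursion =
  fixes f w :: "real \<Rightarrow> real" and a c d b :: real
  assumes cont_f: "continuous_on UNIV f" and nonneg: "\<And>x. 0 \<le> f x"
    and ends: "f a = 0" "f b = 0" and order: "a < c" "c < d" "d < b"
    and pos: "\<And>x. a < x \<Longrightarrow> x < b \<Longrightarrow> 0 < f x"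
    and rise: "mono_on {a..c} f" and fall: "antimono_on {d..b} f"
    and cont_w: "continuous_on UNIV w" and dom: "dominates w f" and w_strict: "w c < w d"
begin

definition g where "g x = (if x \<in> {a<..<b} then f x else 0)"

lemma cont_g: "continuous_on UNIV g"
proof -
  have "g = (\<lambda>x. f (max a (min b x)))"
    using ends order by (auto simp: g_def fun_eq_iff max_def min_def)
  moreover have "continuous_on UNIV (\<lambda>x. f (max a (min b x)))"
    by (rule continuous_on_compose2[OF cont_f]) (auto intro!: continuous_intros)
  ultimately show ?thesis by simp
qed

lemma g_nonneg: "0 \<le> g x" by (simp add: g_def nonneg)

lemma g_rise: "x \<le> y \<Longrightarrow> y \<le> c \<Longrightarrow> g x \<le> g y"
  using monotone_onD[OF rise, of x y] order nonneg by (auto simp: g_def)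

lemma g_fall: "d \<le> x \<Longrightarrow> x \<le> y \<Longrightarrow> g y \<le> g x"
  using monotone_onD[OF fall, of x y] order nonneg by (auto simp: g_def)

text \<open>Rescale \<open>w\<close> to a coordinate \<open>s\<close> that runs from \<open>0\<close> to \<open>k\<close> over the middle part and is constant
outside it.  The hats in \<open>s\<close> form a partition of unity, hence cut \<open>g\<close> into \<open>k + 1\<close> pieces.  If \<open>k\<close> is
large, the hats are so steep compared with \<open>f\<close> that each piece inherits the monotonicity of its
hat on the middle part; on the two end parts the hat is constant and \<open>g\<close> itself is monotone.\<close>

lemma ucat_finite: "ucat g < \<infinity>"
proof -
  obtain q where q: "q \<in> {c..d}" "\<And>x. x \<in> {c..d} \<Longrightarrow> f q \<le> f x"
    using continuous_attains_inf[of "{c..d}" f] order continuous_on_subset[OF cont_f] by auto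
  define \<delta> where "\<delta> = f q"
  have "0 < \<delta>" using pos[of q] q(1) order by (simp add: \<delta>_def)
  \<comment> \<open>One unit of \<open>s\<close> corresponds to an increase of \<open>w\<close> by \<open>h\<close>; the choice of \<open>k\<close> makes \<open>h \<le> \<delta>\<close>.\<close>
  obtain k :: nat where k: "(w d - w c) / \<delta> < real k"
    using reals_Archimedean2 by blast
  define h where "h = (w d - w c) / real k"
  have "0 < (w d - w c) / \<delta>" using w_strict \<open>0 < \<delta>\<close> by simp
  then have "0 < real k" using k by linarith
  have "0 < h" "h \<le> \<delta>"
    using w_strict k \<open>0 < \<delta>\<close> \<open>0 < real k\<close> by (auto simp: h_def field_simps)
  define s where "s x = (w (max c (min d x)) - w c) / h" for x
  have w_mono: "w x \<le> w y" if "x \<le> y" for x y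
    using dominates_imp_mono[OF dom that] .
  have s_mono: "s x \<le> s y" if "x \<le> y" for x y
    using \<open>0 < h\<close> that by (auto simp: s_def intro!: divide_right_mono w_mono)
  have s_c: "s x = 0" if "x \<le> c" for x
    using that order by (simp add: s_def)
  have s_d: "s x = real k" if "d \<le> x" for x
    using that order w_strict \<open>0 < real k\<close> by (simp add: s_def h_def)
  have s_range: "0 \<le> s x" "s x \<le> real k" for x
    using s_mono[of x d] s_mono[of c x] s_c[of c] s_d[of d] s_c[of x] s_d[of x]
    by (cases "x \<le> c"; cases "d \<le> x"; simp)+
  have s_cont: "continuous_on UNIV s"
    unfolding s_def using \<open>0 < h\<close>
    by (intro continuous_intros continuous_on_compose2[OF cont_w]) auto
  have f_le_s: "\<bar>f y - f x\<bar> \<le> \<delta> * (s y - s x)" if "c \<le> x" "x \<le> y" "y \<le> d" for x y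
  proof -
    have "\<bar>f y - f x\<bar> \<le> h * (s y - s x)"
    proof -
      have "h * (s y - s x) = w y - w x"
        using that \<open>0 < h\<close> by (simp add: s_def field_simps)
      then show ?thesis using dominatesD[OF dom, of x y] that by simp
    qed
    also have "\<dots> \<le> \<delta> * (s y - s x)"
      using \<open>h \<le> \<delta>\<close> s_mono[of x y] that by (intro mult_right_mono) auto
    finally show ?thesis .
  qed
  have g_eq: "g x = f x" "\<delta> \<le> g x" if "x \<in> {c..d}" for x
    using that order q by (auto simp: g_def \<delta>_def)
  have piece: "unimodal (\<lambda>x. g x * bump i (s x))" if "i \<le> k" for i
  proof -
    have "\<exists>p. c \<le> p \<and> p \<le> d \<and> s p = real i"
      using that s_c[of c] s_d[of d] order continuous_on_subset[OF s_cont]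
      by (intro IVT') auto
    then obtain p where p: "c \<le> p" "p \<le> d" "s p = real i" by blast
    have bump_left: "bump i (s x) = ramp (s x - real i + 1)" if "x \<le> p" for x
      using s_mono[OF that] p by (simp add: bump_def ramp_def)
    have bump_right: "bump i (s x) = 1 - ramp (s x - real i)" if "p \<le> x" for x
      using s_mono[OF that] p by (simp add: bump_def ramp_def)
    have bump_range: "0 \<le> bump i (s x)" "bump i (s x) \<le> 1" for x
      by (auto simp: bump_def ramp_def)
    have up: "mono_on {..p} (\<lambda>x. g x * bump i (s x))"
    proof (rule mono_on_glue)
      show "mono_on {..c} (\<lambda>x. g x * bump i (s x))"
      proof (rule monotone_onI)
        fix x y assume "x \<in> {..c}" "y \<in> {..c}" "x \<le> y"
        moreover from this have "s x = s y" using s_c by simp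
        ultimately show "g x * bump i (s x) \<le> g y * bump i (s y)"
          using mult_right_mono[OF g_rise[of x y] bump_range(1)[of y]] by simp
      qed
      show "mono_on {c..p} (\<lambda>x. g x * bump i (s x))"
      proof (rule monotone_onI)
        fix x y assume xy: "x \<in> {c..p}" "y \<in> {c..p}" "x \<le> y"
        show "g x * bump i (s x) \<le> g y * bump i (s y)"
        proof (cases "s x \<le> real i - 1")
          case True
          then have "bump i (s x) = 0" by (simp add: bump_def ramp_def)
          then show ?thesis using g_nonneg bump_range by simp
        next
          case False
          then have "bump i (s y) - bump i (s x) = s y - s x"
            using s_mono[of x y] s_mono[of y p] p xy bump_left by (simp add: ramp_def)
          then show ?thesis
            using steep_cutoff[of \<delta> "g y" "g x" "bump i (s y)" "bump i (s x)"]
              \<open>0 < \<delta>\<close> g_eq f_le_s[of x y] bump_range xy p by simp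
        qed
      qed
    qed fact
    have down: "antimono_on {p..} (\<lambda>x. g x * bump i (s x))"
    proof (rule antimono_on_glue)
      show "antimono_on {d..} (\<lambda>x. g x * bump i (s x))"
      proof (rule monotone_onI)
        fix x y assume "x \<in> {d..}" "y \<in> {d..}" "x \<le> y"
        moreover from this have "s x = s y" using s_d by simp
        ultimately show "g y * bump i (s y) \<le> g x * bump i (s x)"
          using mult_right_mono[OF g_fall[of x y] bump_range(1)[of y]] by simp
      qed
      show "antimono_on {p..d} (\<lambda>x. g x * bump i (s x))"
      proof (rule monotone_onI)
        fix x y assume xy: "x \<in> {p..d}" "y \<in> {p..d}" "x \<le> y"
        show "g y * bump i (s y) \<le> g x * bump i (s x)"
        proof (cases "s y \<ge> real i + 1")
          case True
          then have "bump i (s y) = 0" by (simp add: bump_def ramp_def)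
          then show ?thesis using g_nonneg bump_range by simp
        next
          case False
          then have "bump i (s x) - bump i (s y) = s y - s x"
            using s_mono[of x y] s_mono[of p x] p xy bump_right by (simp add: ramp_def)
          then show ?thesis
            using steep_cutoff[of \<delta> "g x" "g y" "bump i (s x)" "bump i (s y)"]
              \<open>0 < \<delta>\<close> g_eq f_le_s[of x y] bump_range xy p by (simp add: abs_minus_commute)
        qed
      qed
    qed fact
    have "0 \<le> g x * bump i (s x)" for x
      using g_nonneg by (intro mult_nonneg_nonneg) (auto simp: bump_range)
    moreover have "continuous_on UNIV (\<lambda>x. g x * bump i (s x))"
      unfolding bump_def ramp_def by (intro continuous_intros cont_g s_cont)
    moreover have "has_peak (\<lambda>x. g x * bump i (s x)) p"
      unfolding has_peak_def using up down by blast
    moreover have "0 < g p * bump i (s p)"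
      using g_eq(2)[of p] p \<open>0 < \<delta>\<close> by (simp add: bump_def ramp_def)
    ultimately show ?thesis unfolding unimodal_iff_has_peak by blast
  qed
  have "ucat (\<lambda>x. \<Sum>i\<in>{..k}. g x * bump i (s x)) < \<infinity>"
    by (intro ucat_sum_finite ucat_unimodal_finite piece) auto
  moreover have "(\<lambda>x. \<Sum>i\<in>{..k}. g x * bump i (s x)) = g"
    using sum_bump[OF s_range] by (simp flip: sum_distrib_left)
  ultimately show ?thesis by (rule back_subst[where P = "\<lambda>h. ucat h < \<infinity>"])
qed

end

section \<open>From monotone ends to a finite sum\<close>

text \<open>The identity is added to the variation to make the dominating function strictly increasing;
otherwise it could not be rescaled when \<open>f\<close> is constant on the middle part.\<close>

lemma ucat_excursion_finite:
  fixes f :: "real \<Rightarrow> real"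
  assumes cont: "continuous_on UNIV f" and nonneg: "\<And>x. 0 \<le> f x" and bv: "bounded_variation f"
    and "\<alpha> < \<beta>" "f \<alpha> = 0" "f \<beta> = 0" "\<And>x. \<alpha> < x \<Longrightarrow> x < \<beta> \<Longrightarrow> 0 < f x"
    and "0 < \<epsilon>" "mono_on {\<alpha>..\<alpha> + \<epsilon>} f" "antimono_on {\<beta> - \<epsilon>..\<beta>} f"
  shows "ucat (\<lambda>x. if x \<in> {\<alpha><..<\<beta>} then f x else 0) < \<infinity>"
proof -
  define \<eta> where "\<eta> = min \<epsilon> ((\<beta> - \<alpha>) / 3)"
  have \<eta>: "0 < \<eta>" "\<eta> \<le> \<epsilon>" "3 * \<eta> \<le> \<beta> - \<alpha>"
    using assms by (auto simp: \<eta>_def min_def)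
  define w where "w x = variation f x + x" for x
  have V: "\<bar>f y - f x\<bar> \<le> variation f y - variation f x" if "x \<le> y" for x y
    using dominatesD[OF variation_dominates[OF bv] that] .
  interpret excursion f w \<alpha> "\<alpha> + \<eta>" "\<beta> - \<eta>" \<beta>
  proof
    show "continuous_on UNIV w"
      unfolding w_def by (intro continuous_intros continuous_variation bv cont)
    show "dominates w f"
      unfolding dominates_def
    proof (intro allI impI)
      fix x y :: real assume "x \<le> y"
      then show "\<bar>f y - f x\<bar> \<le> w y - w x" using V[of x y] by (simp add: w_def)
    qed
    show "w (\<alpha> + \<eta>) < w (\<beta> - \<eta>)"
      using V[of "\<alpha> + \<eta>" "\<beta> - \<eta>"] \<eta> by (simp add: w_def)
    show "mono_on {\<alpha>..\<alpha> + \<eta>} f" "antimono_on {\<beta> - \<eta>..\<beta>} f"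
      by (rule monotone_on_subset[OF assms(9)] monotone_on_subset[OF assms(10)]; use \<eta> in auto)+
  qed (use assms \<eta> in auto)
  show ?thesis using ucat_finite unfolding g_def .
qed

lemma left_end: "{x. ereal \<alpha> \<le> ereal x \<and> ereal x \<le> ereal \<alpha> + ereal \<epsilon>} = {\<alpha>..\<alpha> + \<epsilon>}"
  and right_end: "{x. ereal \<beta> - ereal \<epsilon> \<le> ereal x \<and> ereal x \<le> ereal \<beta>} = {\<beta> - \<epsilon>..\<beta>}"
  by auto

lemma bounded_support:
  fixes f :: "real \<Rightarrow> real"
  assumes "compact (closure {x. f x \<noteq> 0})"
  obtains R where "\<forall>x. R < \<bar>x\<bar> \<longrightarrow> f x = 0"
proof -
  have "bounded {x. f x \<noteq> 0}"
    using compact_imp_bounded[OF assms] bounded_subset closure_subset by blast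
  then obtain R where "\<And>x. f x \<noteq> 0 \<Longrightarrow> \<bar>x\<bar> \<le> R"
    by (auto simp: bounded_iff)
  then show thesis using that[of R] by force
qed

text \<open>Outside \<open>[-R, R]\<close> the function vanishes, so the endpoints are finite and are zeros of \<open>f\<close>.  Hence
\<open>f\<close> is the sum of its excursions over the disjoint intervals, and each of them is a finite sum
of unimodal functions.\<close>

lemma ucat_finite_of_monotone_ends:
  fixes f :: "real \<Rightarrow> real" and a b :: "nat \<Rightarrow> ereal"
  assumes nonneg: "\<And>x. 0 \<le> f x" and cont: "continuous_on UNIV f"
    and supp: "\<forall>x. R < \<bar>x\<bar> \<longrightarrow> f x = 0" and bv: "bounded_variation f"
    and less: "\<And>j. j \<in> {1..m} \<Longrightarrow> a j < b j"
    and ordered: "\<And>j. j \<in> {1..<m} \<Longrightarrow> b j \<le> a (j + 1)"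
    and un: "f -` {0<..} = (\<Union>j\<in>{1..m}. einterval (a j) (b j))"
    and "0 < \<epsilon>"
    and rise: "\<And>j. j \<in> {1..m} \<Longrightarrow> mono_on {x. a j \<le> ereal x \<and> ereal x \<le> a j + ereal \<epsilon>} f"
    and fall: "\<And>j. j \<in> {1..m} \<Longrightarrow> antimono_on {x. b j - ereal \<epsilon> \<le> ereal x \<and> ereal x \<le> b j} f"
  shows "ucat f < \<infinity>"
proof -
  have pos_iff: "0 < f x \<longleftrightarrow> (\<exists>j\<in>{1..m}. a j < ereal x \<and> ereal x < b j)" for x
    using un by (auto simp: einterval_def set_eq_iff)
  have before: "b j \<le> a l" if "j < l" "j \<in> {1..m}" "l \<in> {1..m}" for j l
    using that
  proof (induction l)
    case (Suc l)
    show ?case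
    proof (cases "j = l")
      case True
      then show ?thesis using ordered[of j] Suc.prems by simp
    next
      case False
      then have "b j \<le> a l" using Suc by simp
      also have "a l \<le> b l" using less[of l] Suc.prems by auto
      also have "b l \<le> a (l + 1)" using ordered[of l] Suc.prems by auto
      finally show ?thesis by simp
    qed
  qed simp
  have apart: "b j \<le> a l \<or> b l \<le> a j" if "j \<noteq> l" "j \<in> {1..m}" "l \<in> {1..m}" for j l
    using before[of j l] before[of l j] that by linarith
  have a_fin: "a j \<noteq> -\<infinity>" if j: "j \<in> {1..m}" for j
  proof
    assume "a j = -\<infinity>"
    then have "a j < min (b j) (ereal (- R))" using less[OF j] by simp
    then obtain x where "a j < ereal x" "ereal x < min (b j) (ereal (- R))"
      using ereal_dense2 by blast
    then have "0 < f x" "x < - R" using j pos_iff by auto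
    then show False using supp by auto
  qed
  have b_fin: "b j \<noteq> \<infinity>" if j: "j \<in> {1..m}" for j
  proof
    assume "b j = \<infinity>"
    then have "max (a j) (ereal R) < b j" using less[OF j] by (cases "a j") (auto simp: max_def)
    then obtain x where "max (a j) (ereal R) < ereal x" "ereal x < b j"
      using ereal_dense2 by blast
    then have "0 < f x" "R < x" using j pos_iff by auto
    then show False using supp by auto
  qed
  define \<alpha> where "\<alpha> j = real_of_ereal (a j)" for j
  define \<beta> where "\<beta> j = real_of_ereal (b j)" for j
  have ab: "a j = ereal (\<alpha> j)" "b j = ereal (\<beta> j)" if "j \<in> {1..m}" for j
    using a_fin[OF that] b_fin[OF that] less[OF that] unfolding \<alpha>_def \<beta>_def
    by (cases "a j"; cases "b j"; simp)+
  have ends: "f (\<alpha> j) = 0" "f (\<beta> j) = 0" if j: "j \<in> {1..m}" for j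
  proof -
    have "\<not> (a l < a j \<and> a j < b l)" "\<not> (a l < b j \<and> b j < b l)" if "l \<in> {1..m}" for l
      using apart[of j l] less[OF j] less[OF that] j that by (cases "j = l"; force)+
    then have "\<not> 0 < f (\<alpha> j)" "\<not> 0 < f (\<beta> j)"
      using ab[OF j] unfolding pos_iff by auto
    then show "f (\<alpha> j) = 0" "f (\<beta> j) = 0" using nonneg by (auto intro: order_antisym simp: not_less)
  qed
  define g where "g j x = (if x \<in> {\<alpha> j<..<\<beta> j} then f x else 0)" for j x
  have "ucat (g j) < \<infinity>" if j: "j \<in> {1..m}" for j
    unfolding g_def
  proof (rule ucat_excursion_finite[OF cont nonneg bv _ ends[OF j] _ \<open>0 < \<epsilon>\<close>])
    show "\<alpha> j < \<beta> j" using less[OF j] ab[OF j] by simp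
    show "0 < f x" if "\<alpha> j < x" "x < \<beta> j" for x
      unfolding pos_iff using that ab[OF j] j by (intro bexI[of _ j]) auto
    show "mono_on {\<alpha> j..\<alpha> j + \<epsilon>} f"
      using rise[OF j] unfolding ab[OF j] left_end .
    show "antimono_on {\<beta> j - \<epsilon>..\<beta> j} f"
      using fall[OF j] unfolding ab[OF j] right_end .
  qed
  then have "ucat (\<lambda>x. \<Sum>j\<in>{1..m}. g j x) < \<infinity>"
    by (intro ucat_sum_finite) auto
  moreover have "(\<Sum>j\<in>{1..m}. g j x) = f x" for x
  proof (cases "0 < f x")
    case True
    then obtain j where j: "j \<in> {1..m}" "x \<in> {\<alpha> j<..<\<beta> j}"
      using ab pos_iff by fastforce
    have "x \<notin> {\<alpha> l<..<\<beta> l}" if "l \<in> {1..m}" "l \<noteq> j" for l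
      using apart[of j l] ab[of j] ab[of l] that j by auto
    then have "(\<Sum>l\<in>{1..m}. g l x) = (\<Sum>l\<in>{1..m}. if l = j then f x else 0)"
      using j by (intro sum.cong) (auto simp: g_def)
    then show ?thesis using j by simp
  next
    case False
    then have "f x = 0" using nonneg[of x] by simp
    then show ?thesis unfolding g_def by (intro sum.neutral[THEN trans]) auto
  qed
  ultimately show ?thesis by simp
qed

section \<open>From a finite sum to monotone ends\<close>

text \<open>The peak lies on one side of a zero \<open>z\<close>.  On the other side \<open>u\<close> vanishes altogether, and between
\<open>z\<close> and the peak \<open>u\<close> is monotone.  Phrasing this with a filter lets one choose a common \<open>e\<close> for
finitely many zeros and functions.\<close>

lemma unimodal_monotone_near_zero:
  fixes u :: "real \<Rightarrow> real"
  assumes "unimodal u" "u z = 0"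
  shows "\<forall>\<^sub>F e in at_right 0. mono_on {z..z + e} u \<and> antimono_on {z - e..z} u"
proof -
  from assms(1) obtain p where nonneg: "\<And>x. 0 \<le> u x" and peak: "has_peak u p" and "0 < u p"
    unfolding unimodal_iff_has_peak by blast
  have up: "u x \<le> u y" if "x \<le> y" "y \<le> p" for x y
    using peak that by (auto simp: has_peak_def monotone_on_def)
  have down: "u y \<le> u x" if "p \<le> x" "x \<le> y" for x y
    using peak that by (auto simp: has_peak_def monotone_on_def)
  have "z \<noteq> p" using assms(2) \<open>0 < u p\<close> by auto
  then have "\<forall>\<^sub>F e in at_right 0. e < \<bar>p - z\<bar>"
    by (intro eventually_at_right_less order_tendstoD(2)[OF tendsto_ident_at]) auto
  then show ?thesis
  proof eventually_elim
    case (elim e)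
    show ?case
    proof (cases "z < p")
      case True
      have "u x = 0" if "x \<le> z" for x
        using up[OF that] True nonneg[of x] assms(2) by simp
      then show ?thesis
        using True elim up by (auto simp: monotone_on_def)
    next
      case False
      have "u x = 0" if "z \<le> x" for x
        using down[OF _ that] False nonneg[of x] assms(2) by simp
      then show ?thesis
        using False elim down by (auto simp: monotone_on_def)
    qed
  qed
qed

definition excursion_interval :: "(real \<Rightarrow> real) \<Rightarrow> real \<Rightarrow> real \<Rightarrow> bool" where
  "excursion_interval f y z \<longleftrightarrow> y < z \<and> f y = 0 \<and> f z = 0 \<and> (\<forall>x\<in>{y<..<z}. 0 < f x)"

lemma excursion_interval_unique:
  assumes "excursion_interval f y z" "excursion_interval f y z'" shows "z = z'"
proof -
  have "\<not> z < z'" "\<not> z' < z"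
    using assms unfolding excursion_interval_def by (metis greaterThanLessThan_iff less_irrefl)+
  then show ?thesis by simp
qed

lemma excursion_intervals_ordered:
  assumes "excursion_interval f y z" "excursion_interval f y' z'" "y < y'" shows "z \<le> y'"
  using assms unfolding excursion_interval_def
  by (metis greaterThanLessThan_iff less_irrefl not_le)

text \<open>The endpoints are the last zero before and the first zero after \<open>x\<close>; both exist since the zero
set is closed and unbounded on both sides.\<close>

lemma excursion_interval_exists:
  fixes f :: "real \<Rightarrow> real"
  assumes cont: "continuous_on UNIV f" and nonneg: "\<And>x. 0 \<le> f x"
    and supp: "\<forall>x. R < \<bar>x\<bar> \<longrightarrow> f x = 0" and "0 < f x"
  obtains y z where "excursion_interval f y z" "y < x" "x < z"
proof -
  have zeros: "closed {t. f t = 0}"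
    using cont by (intro closed_Collect_eq continuous_intros)
  define Y where "Y = {t. f t = 0} \<inter> {..x}"
  define Z where "Z = {t. f t = 0} \<inter> {x..}"
  have Y: "closed Y" "bdd_above Y" and Z: "closed Z" "bdd_below Z"
    using zeros by (auto simp: Y_def Z_def closed_Int)
  have "- \<bar>R\<bar> - \<bar>x\<bar> - 1 \<in> Y" "\<bar>R\<bar> + \<bar>x\<bar> + 1 \<in> Z"
    unfolding Y_def Z_def using supp by auto
  then have Sup: "Sup Y \<in> Y" and Inf: "Inf Z \<in> Z"
    using closed_contains_Sup[OF _ Y(2,1)] closed_contains_Inf[OF _ Z(2,1)] by blast+
  have "Sup Y \<noteq> x" "Inf Z \<noteq> x"
    using Sup Inf \<open>0 < f x\<close> by (auto simp: Y_def Z_def)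
  then have ord: "Sup Y < x" "x < Inf Z"
    using Sup Inf by (auto simp: Y_def Z_def)
  have "f t \<noteq> 0" if "Sup Y < t" "t < Inf Z" for t
    using that cSup_upper[OF _ Y(2), of t] cInf_lower[OF _ Z(2), of t]
    by (cases "t \<le> x") (auto simp: Y_def Z_def)
  then have "0 < f t" if "Sup Y < t" "t < Inf Z" for t
    using that nonneg[of t] by (simp add: less_le)
  then have "excursion_interval f (Sup Y) (Inf Z)"
    unfolding excursion_interval_def using ord Sup Inf by (auto simp: Y_def Z_def)
  then show thesis using ord by (rule that)
qed

text \<open>A unimodal summand that is positive in two excursions of \<open>f\<close> would be positive in between, hence
at a zero of \<open>f\<close> separating them.  So assigning to each excursion a summand positive at its
midpoint is injective and there are only finitely many excursions.  At an endpoint of an excursion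
all summands vanish, so all of them, and therefore \<open>f\<close>, are monotone nearby.\<close>

lemma monotone_ends_of_ucat_finite:
  fixes f :: "real \<Rightarrow> real"
  assumes nonneg: "\<And>x. 0 \<le> f x" and cont: "continuous_on UNIV f"
    and supp: "\<forall>x. R < \<bar>x\<bar> \<longrightarrow> f x = 0" and "ucat f < \<infinity>"
  obtains m and a b :: "nat \<Rightarrow> real" and \<epsilon>
  where "\<And>j. j \<in> {1..m} \<Longrightarrow> a j < b j" "\<And>j. j \<in> {1..<m} \<Longrightarrow> b j \<le> a (j + 1)"
    "f -` {0<..} = (\<Union>j\<in>{1..m}. {a j<..<b j})" "0 < \<epsilon>"
    "\<And>j. j \<in> {1..m} \<Longrightarrow> mono_on {a j..a j + \<epsilon>} f"
    "\<And>j. j \<in> {1..m} \<Longrightarrow> antimono_on {b j - \<epsilon>..b j} f"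
proof -
  obtain n :: nat and u
    where u: "\<And>i. i \<in> {1..n} \<Longrightarrow> unimodal (u i)" and f: "\<And>x. f x = (\<Sum>i=1..n. u i x)"
    using assms(4) unfolding ucat_finite_iff by blast
  have u_nonneg: "0 \<le> u i x" if "i \<in> {1..n}" for i x
    using u[OF that] by (simp add: unimodal_def)
  have zero: "u i x = 0" if "f x = 0" "i \<in> {1..n}" for i x
    using that sum_nonneg_eq_0_iff[of "{1..n}" "\<lambda>i. u i x"] u_nonneg unfolding f by auto
  have somewhere: "\<exists>i\<in>{1..n}. 0 < u i x" if "0 < f x" for x
  proof (rule ccontr)
    assume "\<not> ?thesis"
    then have "f x \<le> 0" unfolding f by (intro sum_nonpos) (auto simp: not_less)
    with that show False by simp
  qed
  define A where "A = {y. \<exists>z. excursion_interval f y z}"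
  define right where "right y = (SOME z. excursion_interval f y z)" for y
  have right: "excursion_interval f y (right y)" if "y \<in> A" for y
    using that unfolding A_def right_def by (auto intro: someI)
  define mid where "mid y = (y + right y) / 2" for y
  have mid: "y < mid y" "mid y < right y" if "y \<in> A" for y
    using right[OF that] by (auto simp: mid_def excursion_interval_def)
  have "\<exists>i\<in>{1..n}. 0 < u i (mid y)" if "y \<in> A" for y
    using right[OF that] mid[OF that] somewhere by (auto simp: excursion_interval_def)
  then obtain idx where idx: "\<And>y. y \<in> A \<Longrightarrow> idx y \<in> {1..n} \<and> 0 < u (idx y) (mid y)"
    by metis
  have "inj_on idx A"
  proof (rule linorder_inj_onI)
    fix y y' assume "y < y'" and A: "y \<in> A" "y' \<in> A"
    have "right y \<le> y'"
      using excursion_intervals_ordered[OF right right] A \<open>y < y'\<close> by blast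
    then have m: "mid y < y'" "y' < mid y'" using mid A by force+
    show "idx y \<noteq> idx y'"
    proof
      assume eq: "idx y = idx y'"
      obtain p where p: "has_peak (u (idx y)) p"
        using u idx A unfolding unimodal_iff_has_peak by blast
      have "0 < u (idx y) y'"
      proof (cases "y' \<le> p")
        case True
        then have "u (idx y) (mid y) \<le> u (idx y) y'"
          using p m by (auto simp: has_peak_def monotone_on_def)
        then show ?thesis using idx[OF A(1)] by linarith
      next
        case False
        then have "u (idx y) (mid y') \<le> u (idx y) y'"
          using p m by (auto simp: has_peak_def monotone_on_def)
        then show ?thesis using idx[OF A(2)] eq by simp
      qed
      moreover have "u (idx y) y' = 0"
        using zero idx[OF A(1)] right[OF A(2)] by (auto simp: excursion_interval_def)
      ultimately show False by simp
    qed
  qed auto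
  moreover have "finite (idx ` A)"
    by (rule finite_subset[of _ "{1..n}"]) (use idx in auto)
  ultimately have "finite A" using finite_imageD by blast
  have "\<forall>\<^sub>F e in at_right 0. \<forall>y\<in>A \<union> right ` A. \<forall>i\<in>{1..n}.
      mono_on {y..y + e} (u i) \<and> antimono_on {y - e..y} (u i)"
    using \<open>finite A\<close> right
    by (intro eventually_ball_finite ballI unimodal_monotone_near_zero u zero)
       (auto simp: excursion_interval_def)
  moreover have "\<forall>\<^sub>F e :: real in at_right 0. 0 < e"
    by (rule eventually_at_right_less)
  ultimately have "\<forall>\<^sub>F e in at_right 0. 0 < e \<and> (\<forall>y\<in>A \<union> right ` A. \<forall>i\<in>{1..n}.
      mono_on {y..y + e} (u i) \<and> antimono_on {y - e..y} (u i))"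
    by (rule eventually_conj[rotated])
  then obtain \<epsilon> where "0 < \<epsilon>"
    and eps: "\<And>y i. y \<in> A \<union> right ` A \<Longrightarrow> i \<in> {1..n} \<Longrightarrow>
      mono_on {y..y + \<epsilon>} (u i) \<and> antimono_on {y - \<epsilon>..y} (u i)"
    using eventually_happens'[OF trivial_limit_at_right_real] by blast
  \<comment> \<open>Listing the left endpoints in increasing order puts the excursions in order.\<close>
  define L where "L = sorted_list_of_set A"
  define a where "a j = L ! (j - 1)" for j
  define b where "b j = right (a j)" for j
  have set_L: "A = a ` {1..length L}"
  proof -
    have "A = set L" using \<open>finite A\<close> by (simp add: L_def)
    also have "\<dots> = a ` {1..length L}"
      unfolding set_conv_nth a_def by (force simp: image_iff Bex_def intro: exI[of _ "Suc _"])
    finally show ?thesis .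
  qed
  then have exc: "excursion_interval f (a j) (b j)" if "j \<in> {1..length L}" for j
    using that right unfolding b_def by blast
  show thesis
  proof (rule that[of "length L" a b \<epsilon>])
    show "a j < b j" if "j \<in> {1..length L}" for j
      using exc[OF that] by (simp add: excursion_interval_def)
    show "b j \<le> a (j + 1)" if "j \<in> {1..<length L}" for j
    proof (rule excursion_intervals_ordered)
      show "excursion_interval f (a j) (b j)" "excursion_interval f (a (j + 1)) (b (j + 1))"
        using exc that by auto
      have "sorted_wrt (<) L" unfolding L_def by simp
      then show "a j < a (j + 1)"
        using sorted_wrt_nth_less[of "(<)" L "j - 1" j] that by (simp add: a_def)
    qed
    show "f -` {0<..} = (\<Union>j\<in>{1..length L}. {a j<..<b j})"
    proof (intro equalityI subsetI)
      fix x assume "x \<in> f -` {0<..}"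
      then have "0 < f x" by simp
      then obtain y z where yz: "excursion_interval f y z" "y < x" "x < z"
        using excursion_interval_exists[OF cont nonneg supp] by blast
      then have "y \<in> A" by (auto simp: A_def)
      then have "z = right y" using excursion_interval_unique[OF yz(1) right] by blast
      with yz \<open>y \<in> A\<close> show "x \<in> (\<Union>j\<in>{1..length L}. {a j<..<b j})"
        unfolding set_L b_def by auto
    next
      fix x assume "x \<in> (\<Union>j\<in>{1..length L}. {a j<..<b j})"
      then show "x \<in> f -` {0<..}"
        using exc by (auto simp: excursion_interval_def)
    qed
    fix j assume j: "j \<in> {1..length L}"
    then have "a j \<in> A" unfolding set_L by blast
    then have "a j \<in> A \<union> right ` A" "b j \<in> A \<union> right ` A" by (auto simp: b_def)
    from eps[OF this(1)] eps[OF this(2)]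
    show "mono_on {a j..a j + \<epsilon>} f" "antimono_on {b j - \<epsilon>..b j} f"
      unfolding f monotone_on_def by (auto intro!: sum_mono)
  qed fact
qed

theorem theorem3p7:
  fixes f :: "real \<Rightarrow> real"
  assumes "\<And>x. 0 \<le> f x"
    and "continuous_on UNIV f"
    and "compact (closure {x. f x \<noteq> 0})"
    and "bounded_variation f"
  shows "ucat f < \<infinity> \<longleftrightarrow>
    (\<exists>(m::nat) (a :: nat \<Rightarrow> ereal) (b :: nat \<Rightarrow> ereal).
       (\<forall>j\<in>{1..m}. a j < b j) \<and>
       (\<forall>j\<in>{1..<m}. b j \<le> a (j + 1)) \<and>
       f -` {0<..} = (\<Union>j\<in>{1..m}. einterval (a j) (b j)) \<and>
       (\<exists>\<epsilon>::real. \<epsilon> > 0 \<and>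
         (\<forall>j\<in>{1..m}.
            mono_on {x. a j \<le> ereal x \<and> ereal x \<le> a j + ereal \<epsilon>} f \<and>
            antimono_on {x. b j - ereal \<epsilon> \<le> ereal x \<and> ereal x \<le> b j} f)))"
    (is "_ \<longleftrightarrow> ?monotone_ends")
proof -
  obtain R where supp: "\<forall>x. R < \<bar>x\<bar> \<longrightarrow> f x = 0"
    using bounded_support[OF assms(3)] by blast
  show ?thesis
  proof
    assume "ucat f < \<infinity>"
    then show ?monotone_ends
    proof (rule monotone_ends_of_ucat_finite[OF assms(1,2) supp])
      fix m and a b :: "nat \<Rightarrow> real" and \<epsilon>
      assume "\<And>j. j \<in> {1..m} \<Longrightarrow> a j < b j" "\<And>j. j \<in> {1..<m} \<Longrightarrow> b j \<le> a (j + 1)"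
        "f -` {0<..} = (\<Union>j\<in>{1..m}. {a j<..<b j})" "0 < \<epsilon>"
        "\<And>j. j \<in> {1..m} \<Longrightarrow> mono_on {a j..a j + \<epsilon>} f"
        "\<And>j. j \<in> {1..m} \<Longrightarrow> antimono_on {b j - \<epsilon>..b j} f"
      then have "(\<forall>j\<in>{1..m}. ereal (a j) < ereal (b j)) \<and>
         (\<forall>j\<in>{1..<m}. ereal (b j) \<le> ereal (a (j + 1))) \<and>
         f -` {0<..} = (\<Union>j\<in>{1..m}. einterval (ereal (a j)) (ereal (b j))) \<and>
         \<epsilon> > 0 \<and>
         (\<forall>j\<in>{1..m}.
           mono_on {x. ereal (a j) \<le> ereal x \<and> ereal x \<le> ereal (a j) + ereal \<epsilon>} f \<and>
           antimono_on {x. ereal (b j) - ereal \<epsilon> \<le> ereal x \<and> ereal x \<le> ereal (b j)} f)"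
        unfolding right_end left_end einterval_eq by simp
      then show ?monotone_ends
        by - (rule exI[of _ m], rule exI[of _ "\<lambda>j. ereal (a j)"],
            rule exI[of _ "\<lambda>j. ereal (b j)"], blast)
    qed
  next
    assume ?monotone_ends
    then obtain m :: nat and a b and \<epsilon> :: real where
      "\<forall>j\<in>{1..m}. a j < b j" "\<forall>j\<in>{1..<m}. b j \<le> a (j + 1)"
      "f -` {0<..} = (\<Union>j\<in>{1..m}. einterval (a j) (b j))" "\<epsilon> > 0"
      "\<forall>j\<in>{1..m}. mono_on {x. a j \<le> ereal x \<and> ereal x \<le> a j + ereal \<epsilon>} f \<and>
        antimono_on {x. b j - ereal \<epsilon> \<le> ereal x \<and> ereal x \<le> b j} f"
      by (elim exE conjE)
    then show "ucat f < \<infinity>"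
      by (intro ucat_finite_of_monotone_ends[OF assms(1,2) supp assms(4), where a = a and b = b
            and m = m and \<epsilon> = \<epsilon>]) simp_all
  qed
qed

end
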